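(* Let $X$ be a compact connected topological space and $f: X \to \mathbb{R}$ a continuous function. Then $(T_f,\mathrm{t}_f)$ has hyperbolicity zero. If $X$ is a geodesic space, then $T_f$ is a metric tree.
   Context: Geodesic space: a metric space in which any two points are joined by a path whose length equals their distance. Metric tree: a geodesic space in which, up to reparametrization, there is a unique simple (injective) path between each pair of points. The merge function of $f$ is $$m_f(x,x'):=\inf\{\sup(f|_A): A\subseteq X,\ x,x'\in A,\ A \text{ connected}\},$$ and $\mathrm{t}_f(x,x'):=2m_f(x,x')-f(x)-f(x')$ is a pseudometric on $X$. The merge metric tree $(T_f,\mathrm{t}_f)$ is the metric space obtained from $X$ by identifying points at $\mathrm{t}_f$-distance $0$. Hyperbolicity: for a metric space $(Z,d_Z)$ and $p\in Z$, the Gromov product is $g_p(x,x'):=\frac12\bigl(d_Z(p,x)+d_Z(p,x')-d_Z(x,x')\bigr)$; $\mathrm{hyp}_p(Z)$ is the infimum of all $\delta\ge 0$ such that $g_p(x,x'')\ge\min(g_p(x,x'),g_p(x',x''))-\delta$ for all $x,x',x''\in Z$; and the hyperbolicity is $\mathrm{hyp}(Z):=\sup_{p\in Z}\mathrm{hyp}_p(Z)$. *)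

theory Defs
  imports "HOL-Analysis.Analysis"
begin

definition merge_fun :: "'a topology \<Rightarrow> ('a \<Rightarrow> real) \<Rightarrow> 'a \<Rightarrow> 'a \<Rightarrow> real" where
  "merge_fun X f x x' =
     Inf {Sup (f ` A) | A. connectedin X A \<and> x \<in> A \<and> x' \<in> A}"

definition merge_pdist :: "'a topology \<Rightarrow> ('a \<Rightarrow> real) \<Rightarrow> 'a \<Rightarrow> 'a \<Rightarrow> real" where
  "merge_pdist X f x x' = 2 * merge_fun X f x x' - f x - f x'"

definition merge_rel :: "'a topology \<Rightarrow> ('a \<Rightarrow> real) \<Rightarrow> ('a \<times> 'a) set" where
  "merge_rel X f =
     {(x, x'). x \<in> topspace X \<and> x' \<in> topspace X \<and> merge_pdist X f x x' = 0}"

definition merge_tree :: "'a topology \<Rightarrow> ('a \<Rightarrow> real) \<Rightarrow> 'a set set" where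
  "merge_tree X f = topspace X // merge_rel X f"

text \<open>The choice of representatives is irrelevant whenever the distance on points is a
  pseudometric. Outside the carrier the value is set to 0, because the locale
  \<^locale>\<open>Metric_space\<close> demands nonnegativity and symmetry on the whole type.\<close>
definition merge_dist :: "'a topology \<Rightarrow> ('a \<Rightarrow> real) \<Rightarrow> 'a set \<Rightarrow> 'a set \<Rightarrow> real" where
  "merge_dist X f P Q =
     (if P \<in> merge_tree X f \<and> Q \<in> merge_tree X f
      then merge_pdist X f (SOME x. x \<in> P) (SOME y. y \<in> Q) else 0)"

definition gromov_product :: "('a \<Rightarrow> 'a \<Rightarrow> real) \<Rightarrow> 'a \<Rightarrow> 'a \<Rightarrow> 'a \<Rightarrow> real" where
  "gromov_product d p x x' = (d p x + d p x' - d x x') / 2"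

text \<open>Hyperbolicity takes values in \<open>[0, \<infinity>]\<close>: the infimum over the empty set is \<open>\<infinity>\<close>, and
  the supremum over the points of the empty space is \<open>0\<close>.\<close>
definition hyp_at :: "'a set \<Rightarrow> ('a \<Rightarrow> 'a \<Rightarrow> real) \<Rightarrow> 'a \<Rightarrow> ennreal" where
  "hyp_at Z d p =
     Inf {ennreal \<delta> | \<delta>. 0 \<le> \<delta> \<and>
       (\<forall>x\<in>Z. \<forall>x'\<in>Z. \<forall>x''\<in>Z.
          gromov_product d p x x''
            \<ge> min (gromov_product d p x x') (gromov_product d p x' x'') - \<delta>)}"

definition hyperbolicity :: "'a set \<Rightarrow> ('a \<Rightarrow> 'a \<Rightarrow> real) \<Rightarrow> ennreal" where
  "hyperbolicity Z d = (SUP p\<in>Z. hyp_at Z d p)"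

definition path_length :: "('a \<Rightarrow> 'a \<Rightarrow> real) \<Rightarrow> (real \<Rightarrow> 'a) \<Rightarrow> ennreal" where
  "path_length d g =
     Sup {ennreal (\<Sum>i<n. d (g (s i)) (g (s (Suc i)))) | (n::nat) s.
            s 0 = 0 \<and> s n = 1 \<and> mono_on {..n} s}"

definition geodesic_space :: "'a set \<Rightarrow> ('a \<Rightarrow> 'a \<Rightarrow> real) \<Rightarrow> bool" where
  "geodesic_space M d \<longleftrightarrow>
     Metric_space M d \<and>
     (\<forall>x\<in>M. \<forall>y\<in>M. \<exists>g. pathin (Metric_space.mtopology M d) g \<and> g 0 = x \<and> g 1 = y \<and>
        path_length d g = ennreal (d x y))"

definition simple_path_between ::
    "'a topology \<Rightarrow> 'a \<Rightarrow> 'a \<Rightarrow> (real \<Rightarrow> 'a) \<Rightarrow> bool" where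
  "simple_path_between X x y g \<longleftrightarrow> pathin X g \<and> inj_on g {0..1} \<and> g 0 = x \<and> g 1 = y"

definition reparametrization :: "(real \<Rightarrow> 'a) \<Rightarrow> (real \<Rightarrow> 'a) \<Rightarrow> bool" where
  "reparametrization g h \<longleftrightarrow>
     (\<exists>\<phi> \<psi>. homeomorphism {0..1} {0..1} \<phi> \<psi> \<and> \<phi> 0 = 0 \<and> \<phi> 1 = 1 \<and>
        (\<forall>t\<in>{0..1}. h t = g (\<phi> t)))"

text \<open>The two points are required to be distinct, since no injective map on \<open>[0, 1]\<close> joins a
  point to itself.\<close>
definition metric_tree :: "'a set \<Rightarrow> ('a \<Rightarrow> 'a \<Rightarrow> real) \<Rightarrow> bool" where
  "metric_tree M d \<longleftrightarrow>
     geodesic_space M d \<and>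
     (\<forall>x\<in>M. \<forall>y\<in>M. x \<noteq> y \<longrightarrow>
        (\<exists>g. simple_path_between (Metric_space.mtopology M d) x y g \<and>
           (\<forall>h. simple_path_between (Metric_space.mtopology M d) x y h \<longrightarrow>
              reparametrization g h)))"

end

theory Submission
  imports Defs
begin

text \<open>
  The merge function satisfies the ultrametric inequality
  \<open>m(x,z) \<le> max (m(x,y)) (m(y,z))\<close>, because the union of two connected sets that share \<open>y\<close> is
  connected. As \<open>m(x,y) \<ge> f x\<close> and \<open>m(x,x) = f x\<close>, this makes the merge distance a pseudometric.
  Its Gromov products are \<open>m(p,x) + m(p,y) - m(x,y) - f p\<close>, and for these the inequality of
  hyperbolicity with constant zero is the four-point inequality, which holds for every symmetric
  function with the ultrametric inequality.

  For the second half it suffices that a connected \<open>0\<close>-hyperbolic metric space is a metric tree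
  (\<open>metric_tree_if_connected\<close>). The heart of that is the following. Let \<open>S\<close> be a connected subset
  that contains \<open>x\<close> and \<open>y\<close>, and let \<open>0 < r < d x y\<close>. Points \<open>z\<close> for which the Gromov product of
  \<open>z\<close> and \<open>y\<close> at \<open>x\<close> is less than \<open>r\<close> branch off the way from \<open>x\<close> to \<open>y\<close> before distance \<open>r\<close>. If
  \<open>S\<close> had no point on this way at distance \<open>r\<close>, these points and the others would
  split \<open>S\<close> into two open pieces. For \<open>S\<close> the whole space this yields geodesics. For \<open>S\<close> the
  image of an arbitrary simple path it shows that the path runs through all of the geodesic, so
  that the geodesic, written in the parameter of the path, is an injective continuous map of
  \<open>[0,1]\<close> to itself that fixes \<open>0\<close> and \<open>1\<close>; hence the two paths agree up to reparametrization.

  Finally, a geodesic space is locally connected, and local connectedness together with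
  continuity of \<open>f\<close> makes the projection onto the merge tree continuous. The merge tree is
  therefore connected, and the criterion applies.
\<close>

section \<open>Connected \<open>0\<close>-hyperbolic spaces are metric trees\<close>

locale zero_hyperbolic_space = Metric_space M d for M :: "'a set" and d +
  assumes hyp0: "\<lbrakk>p \<in> M; x \<in> M; y \<in> M; z \<in> M\<rbrakk> \<Longrightarrow>
    min (gromov_product d p x y) (gromov_product d p y z) \<le> gromov_product d p x z"
begin

lemma hyperbolicity_zero: "hyperbolicity M d = 0"
proof -
  have "hyp_at M d p = 0" if "p \<in> M" for p
  proof -
    have "hyp_at M d p \<le> ennreal 0"
      unfolding hyp_at_def by (rule Inf_lower) (use hyp0 that in force)
    then show ?thesis by simp
  qed
  then have "hyperbolicity M d \<le> 0"
    unfolding hyperbolicity_def by (intro SUP_least) simp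
  then show ?thesis by simp
qed

lemma openin_mtopologyI:
  assumes "U \<subseteq> M" and "\<And>z. z \<in> U \<Longrightarrow> 0 < e z"
    and "\<And>z w. \<lbrakk>z \<in> U; w \<in> M; d z w < e z\<rbrakk> \<Longrightarrow> w \<in> U"
  shows "openin mtopology U"
  unfolding openin_mtopology
proof (intro conjI allI impI assms(1))
  fix z assume "z \<in> U"
  then show "\<exists>r>0. mball z r \<subseteq> U"
    using assms by (intro exI[of _ "e z"]) auto
qed

text \<open>In the proof, \<open>U\<close> consists of the points that branch off before distance \<open>r\<close>, and \<open>V\<close> of those
  that branch off at distance \<open>r\<close> or later and lie farther than \<open>r\<close> from \<open>x\<close>; only the point sought
  is in neither. Openness of \<open>V\<close> is where hyperbolicity enters: the ways from \<open>x\<close> to \<open>z \<in> V\<close> and to a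
  point near \<open>z\<close> part only beyond distance \<open>r\<close>, so neither leaves the way to \<open>y\<close> before that distance.\<close>
lemma geodesic_point_in_connected:
  assumes S: "connectedin mtopology S" and x: "x \<in> S" and y: "y \<in> S"
    and r: "0 \<le> r" "r \<le> d x y"
  obtains z where "z \<in> S" "d x z = r" "d z y = d x y - r"
proof (cases "r = 0 \<or> r = d x y")
  case True
  have "x \<in> M" "y \<in> M" using S x y connectedin_subset_topspace by fastforce+
  then show ?thesis using True that x y by fastforce
next
  case False
  with r have r': "0 < r" "r < d x y" by auto
  have SM: "S \<subseteq> M" using S connectedin_subset_topspace by fastforce
  then have xM: "x \<in> M" and yM: "y \<in> M" using x y by auto
  let ?g = "\<lambda>z. gromov_product d x z y"
  define U where "U = {z \<in> M. ?g z < r}"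
  define V where "V = {z \<in> M. r \<le> ?g z \<and> r < d x z}"
  have U: "openin mtopology U"
  proof (rule openin_mtopologyI)
    show "0 < r - ?g z" if "z \<in> U" for z using that by (simp add: U_def)
    fix z w assume z: "z \<in> U" and w: "w \<in> M" "d z w < r - ?g z"
    then have "z \<in> M" by (simp add: U_def)
    then have "d x w \<le> d x z + d z w" "d z y \<le> d z w + d w y"
      using xM yM w triangle by blast+
    with w show "w \<in> U" by (simp add: U_def gromov_product_def field_simps)
  qed (auto simp: U_def)
  have V: "openin mtopology V"
  proof (rule openin_mtopologyI)
    show "0 < d x z - r" if "z \<in> V" for z using that by (simp add: V_def)
    fix z w assume z: "z \<in> V" and w: "w \<in> M" "d z w < d x z - r"
    then have zM: "z \<in> M" by (simp add: V_def)
    then have "d x z \<le> d x w + d z w"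
      using xM w triangle[of x w z] by (simp add: commute)
    moreover from this have "r \<le> gromov_product d x w z"
      using w by (simp add: gromov_product_def commute)
    moreover have "min (gromov_product d x w z) (?g z) \<le> ?g w"
      by (rule hyp0) (use xM yM zM w in auto)
    ultimately show "w \<in> V" using z w by (auto simp: V_def)
  qed (auto simp: V_def)
  have "x \<in> U" "y \<in> V" using xM yM r' by (auto simp: U_def V_def gromov_product_def)
  moreover have "U \<inter> V = {}" by (auto simp: U_def V_def)
  ultimately have "\<not> S \<subseteq> U \<union> V"
    using S U V x y unfolding connectedin by blast
  then obtain z where z: "z \<in> S" "r \<le> ?g z" "d x z \<le> r"
    using SM by (force simp: U_def V_def)
  have "d x y \<le> d x z + d z y" "d x z \<le> d x y + d z y"
    using triangle[of x z y] triangle[of x y z] xM yM z SM by (auto simp: commute)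
  with z show ?thesis by (intro that[of z]) (auto simp: gromov_product_def)
qed

text \<open>Both \<open>z\<close> and \<open>w\<close> lie between \<open>x\<close> and \<open>y\<close>, so their Gromov products with \<open>y\<close> at \<open>x\<close> are
  \<open>d x z\<close> and \<open>d x w\<close>. Hyperbolicity then makes the product of \<open>z\<close> and \<open>w\<close> at least the smaller of
  the two: \<open>z\<close> and \<open>w\<close> lie on one geodesic. In particular a point between \<open>x\<close> and \<open>y\<close> is
  determined by its distance from \<open>x\<close>.\<close>
lemma dist_between_geodesic_points:
  assumes "x \<in> M" "y \<in> M" "z \<in> M" "w \<in> M"
    and "d x z + d z y = d x y" "d x w + d w y = d x y"
  shows "d z w = \<bar>d x z - d x w\<bar>"
proof -
  have "min (gromov_product d x z y) (gromov_product d x y w) \<le> gromov_product d x z w"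
    by (rule hyp0) (use assms in auto)
  then have "d z w \<le> \<bar>d x z - d x w\<bar>"
    using assms by (auto simp: gromov_product_def commute min_def field_simps split: if_splits)
  moreover have "d x z \<le> d x w + d z w" "d x w \<le> d x z + d z w"
    using triangle[of x w z] triangle[of x z w] assms by (auto simp: commute)
  ultimately show ?thesis by linarith
qed

text \<open>A connected set through \<open>x\<close> and \<open>y\<close> has a point between them at each distance up to \<open>d x y\<close>
  from \<open>x\<close>, and there is only one candidate.\<close>
lemma geodesic_points_subset_connected:
  assumes S: "connectedin mtopology S" and x: "x \<in> S" and y: "y \<in> S"
    and w: "w \<in> M" "d x w + d w y = d x y"
  shows "w \<in> S"
proof -
  have SM: "S \<subseteq> M" using S connectedin_subset_topspace by fastforce
  have "d x w \<le> d x y" using w(2) nonneg[of w y] by linarith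
  then obtain z where z: "z \<in> S" "d x z = d x w" "d z y = d x y - d x w"
    using geodesic_point_in_connected[OF S x y, of "d x w"] by auto
  have "d z w = \<bar>d x z - d x w\<bar>"
    by (rule dist_between_geodesic_points[of x y]) (use z w SM x y in auto)
  then have "d z w = 0" using z by simp
  then show ?thesis using z w SM by auto
qed

lemma constant_speed_geodesic:
  assumes conn: "connected_space mtopology" and x: "x \<in> M" and y: "y \<in> M"
  obtains g where "\<And>t. t \<in> {0..1} \<Longrightarrow> g t \<in> M" "g 0 = x" "g 1 = y"
    "\<And>s t. \<lbrakk>s \<in> {0..1}; t \<in> {0..1}\<rbrakk> \<Longrightarrow> d (g s) (g t) = \<bar>s - t\<bar> * d x y"
proof -
  have M: "connectedin mtopology M" using conn by (simp flip: connectedin_topspace)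
  have "\<exists>z. z \<in> M \<and> d x z = t * d x y \<and> d z y = d x y - t * d x y" if "t \<in> {0..1}" for t
  proof -
    have "t * d x y \<le> d x y" using that by (intro mult_left_le_one_le) auto
    then show ?thesis
      using geodesic_point_in_connected[OF M x y, of "t * d x y"] that
      by (metis atLeastAtMost_iff mult_nonneg_nonneg nonneg)
  qed
  then obtain g where g: "\<And>t. t \<in> {0..1} \<Longrightarrow>
      g t \<in> M \<and> d x (g t) = t * d x y \<and> d (g t) y = d x y - t * d x y" by metis
  show ?thesis
  proof (rule that)
    show "g t \<in> M" if "t \<in> {0..1}" for t using g that by blast
    show "g 0 = x" using g[of 0] x by auto
    show "g 1 = y" using g[of 1] y by auto
    fix s t :: real assume st: "s \<in> {0..1}" "t \<in> {0..1}"
    then have "d (g s) (g t) = \<bar>d x (g s) - d x (g t)\<bar>"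
      using g x y by (intro dist_between_geodesic_points[of x y]) auto
    also have "\<dots> = \<bar>(s - t) * d x y\<bar>" using g st by (simp add: left_diff_distrib)
    finally show "d (g s) (g t) = \<bar>s - t\<bar> * d x y" by (simp add: abs_mult)
  qed
qed

end

text \<open>Along a monotone partition the distances telescope, so every inscribed sum already equals \<open>c\<close>.\<close>
lemma constant_speed_path_length:
  assumes g: "\<And>s t. \<lbrakk>s \<in> {0..1}; t \<in> {0..1}\<rbrakk> \<Longrightarrow> d (g s) (g t) = \<bar>s - t\<bar> * c"
  shows "path_length d g = ennreal c"
proof -
  have sum: "(\<Sum>i<n. d (g (s i)) (g (s (Suc i)))) = c"
    if s: "s 0 = 0" "s n = 1" "mono_on {..n} s" for n and s :: "nat \<Rightarrow> real"
  proof -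
    have s01: "s i \<in> {0..1}" if "i \<le> n" for i
      using monotone_onD[OF s(3), of 0 i] monotone_onD[OF s(3), of i n] s(1,2) that by auto
    have "(\<Sum>i<n. d (g (s i)) (g (s (Suc i)))) = (\<Sum>i<n. (s (Suc i) - s i) * c)"
    proof (rule sum.cong)
      fix i assume "i \<in> {..<n}"
      then show "d (g (s i)) (g (s (Suc i))) = (s (Suc i) - s i) * c"
        using g[OF s01 s01, of i "Suc i"] monotone_onD[OF s(3), of i "Suc i"] by auto
    qed simp
    also have "\<dots> = (\<Sum>i<n. s (Suc i) - s i) * c" by (simp add: sum_distrib_right)
    also have "\<dots> = c" using s by (simp add: sum_lessThan_telescope)
    finally show ?thesis .
  qed
  have "\<exists>(n::nat) s. s 0 = (0::real) \<and> s n = 1 \<and> mono_on {..n} s"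
    by (intro exI[of _ "1::nat"] exI[of _ real] conjI) (auto simp: monotone_on_def)
  then have "{ennreal (\<Sum>i<n. d (g (s i)) (g (s (Suc i)))) | (n::nat) s.
            s 0 = 0 \<and> s n = 1 \<and> mono_on {..n} s} = {ennreal c}"
    using sum by auto
  then show ?thesis by (simp add: path_length_def)
qed

lemma (in Metric_space) pathin_if_constant_speed:
  assumes gM: "\<And>t. t \<in> {0..1} \<Longrightarrow> g t \<in> M"
    and g: "\<And>s t. \<lbrakk>s \<in> {0..1}; t \<in> {0..1}\<rbrakk> \<Longrightarrow> d (g s) (g t) = \<bar>s - t\<bar> * c"
  shows "pathin mtopology g"
  unfolding pathin_def continuous_map_to_metric
proof (intro ballI allI impI)
  fix s \<epsilon> :: real assume s: "s \<in> topspace (top_of_set {0..1})" and \<epsilon>: "0 < \<epsilon>"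
  (* The summand 1 covers a constant path, for which c = 0. *)
  define \<delta> where "\<delta> = \<epsilon> / (\<bar>c\<bar> + 1)"
  have \<delta>: "0 < \<delta>" using \<epsilon> by (simp add: \<delta>_def)
  have "g t \<in> mball (g s) \<epsilon>" if "t \<in> {0..1} \<inter> ball s \<delta>" for t
  proof -
    have "d (g s) (g t) \<le> \<bar>s - t\<bar> * (\<bar>c\<bar> + 1)"
      using g[of s t] s that by (auto intro!: mult_left_mono)
    also have "\<dots> < \<delta> * (\<bar>c\<bar> + 1)"
      using that by (intro mult_strict_right_mono) (auto simp: dist_real_def)
    also have "\<dots> = \<epsilon>" by (simp add: \<delta>_def)
    finally show ?thesis using gM s that by auto
  qed
  then show "\<exists>U. openin (top_of_set {0..1}) U \<and> s \<in> U \<and> (\<forall>t\<in>U. g t \<in> mball (g s) \<epsilon>)"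
    using s \<delta> by (intro exI[of _ "{0..1} \<inter> ball s \<delta>"]) auto
qed

text \<open>The change of parameter is \<open>\<psi> = h\<^sup>-\<^sup>1 \<circ> g\<close>. It is continuous because a simple path in a Hausdorff
  space is a homeomorphism onto its image, and it is onto \<open>[0,1]\<close> by the intermediate value
  theorem, so that the images of \<open>g\<close> and \<open>h\<close> agree after all.\<close>
lemma reparametrization_if_image_subset:
  assumes "Hausdorff_space X"
    and g: "simple_path_between X x y g" and h: "simple_path_between X x y h"
    and sub: "g ` {0..1} \<subseteq> h ` {0..1}"
  shows "reparametrization g h"
proof -
  let ?I = "{0..1::real}"
  define k where "k = inv_into ?I h"
  define \<psi> where "\<psi> = k \<circ> g"
  have kh: "k (h t) = t" if "t \<in> ?I" for t
    using h that by (simp add: k_def simple_path_between_def)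
  have hk: "h (\<psi> t) = g t" and \<psi>I: "\<psi> t \<in> ?I" if "t \<in> ?I" for t
    using sub that by (auto simp: \<psi>_def k_def f_inv_into_f inv_into_into image_subset_iff
        simp del: atLeastAtMost_iff)
  have "continuous_map (subtopology X (h ` ?I)) (top_of_set ?I) k"
    by (rule continuous_inverse_map[where f = h])
       (use assms kh in \<open>auto simp: simple_path_between_def pathin_def compact_space_subtopology\<close>)
  moreover have "continuous_map (top_of_set ?I) (subtopology X (h ` ?I)) g"
    using g sub by (auto simp: simple_path_between_def pathin_def continuous_map_in_subtopology)
  ultimately have "continuous_map (top_of_set ?I) (top_of_set ?I) \<psi>"
    unfolding \<psi>_def by (rule continuous_map_compose[rotated])
  then have cont: "continuous_on ?I \<psi>"
    by (simp add: continuous_map_in_subtopology)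
  have ends: "\<psi> 0 = 0" "\<psi> 1 = 1"
    using g h kh[of 0] kh[of 1] by (auto simp: \<psi>_def simple_path_between_def)
  have img: "\<psi> ` ?I = ?I"
  proof
    show "?I \<subseteq> \<psi> ` ?I"
    proof
      fix s assume "s \<in> ?I"
      then show "s \<in> \<psi> ` ?I" using IVT'[of \<psi> 0 s 1] ends cont by auto
    qed
  qed (use \<psi>I in blast)
  have "inj_on \<psi> ?I"
    using g hk unfolding simple_path_between_def inj_on_def by metis
  then obtain \<phi> where hom: "homeomorphism ?I ?I \<psi> \<phi>"
    using homeomorphism_compact[OF _ cont img] by auto
  have "homeomorphism ?I ?I \<phi> \<psi>" by (rule homeomorphism_symD[OF hom])
  moreover have "\<phi> 0 = 0" "\<phi> 1 = 1"
    using homeomorphism_apply1[OF hom, of 0] homeomorphism_apply1[OF hom, of 1] ends by auto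
  moreover have "h t = g (\<phi> t)" if "t \<in> ?I" for t
  proof -
    have "\<phi> t \<in> ?I" "\<psi> (\<phi> t) = t"
      using hom that by (auto simp: homeomorphism_def simp del: atLeastAtMost_iff)
    then show ?thesis using hk[of "\<phi> t"] by simp
  qed
  ultimately show ?thesis unfolding reparametrization_def by blast
qed

theorem (in zero_hyperbolic_space) metric_tree_if_connected:
  assumes conn: "connected_space mtopology"
  shows "metric_tree M d"
  unfolding metric_tree_def geodesic_space_def
proof (intro conjI ballI impI)
  show "Metric_space M d" by (rule Metric_space_axioms)
next
  fix x y assume xy: "x \<in> M" "y \<in> M"
  obtain g where g: "\<And>t. t \<in> {0..1} \<Longrightarrow> g t \<in> M" "g 0 = x" "g 1 = y"
    "\<And>s t. \<lbrakk>s \<in> {0..1}; t \<in> {0..1}\<rbrakk> \<Longrightarrow> d (g s) (g t) = \<bar>s - t\<bar> * d x y"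
    by (rule constant_speed_geodesic[OF conn xy]) blast
  have path: "pathin mtopology g" by (rule pathin_if_constant_speed[OF g(1,4)])
  have "path_length d g = ennreal (d x y)" by (rule constant_speed_path_length) (rule g(4))
  with g path show "\<exists>g. pathin mtopology g \<and> g 0 = x \<and> g 1 = y \<and>
      path_length d g = ennreal (d x y)" by blast
  assume neq: "x \<noteq> y"
  have "inj_on g {0..1}"
  proof (rule inj_onI)
    fix s t :: real assume st: "s \<in> {0..1}" "t \<in> {0..1}" "g s = g t"
    then have "\<bar>s - t\<bar> * d x y = 0" using g(1,4)[of s] g(4)[of s t] by simp
    with neq xy show "s = t" by simp
  qed
  with g path have simple: "simple_path_between mtopology x y g"
    by (simp add: simple_path_between_def)
  moreover have "reparametrization g h" if h: "simple_path_between mtopology x y h" for h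
  proof (rule reparametrization_if_image_subset[OF Hausdorff_space_mtopology simple h])
    have "connectedin mtopology (h ` {0..1})"
      using h by (simp add: simple_path_between_def connectedin_path_image)
    moreover have "x \<in> h ` {0..1}" "y \<in> h ` {0..1}"
      using h by (force simp: simple_path_between_def)+
    moreover have "d x (g t) + d (g t) y = d x y" if "t \<in> {0..1}" for t
      using g(4)[of 0 t] g(4)[of t 1] g(2,3) that by (simp add: left_diff_distrib)
    ultimately show "g ` {0..1} \<subseteq> h ` {0..1}"
      using g(1) geodesic_points_subset_connected by blast
  qed
  ultimately show "\<exists>g. simple_path_between mtopology x y g \<and>
      (\<forall>h. simple_path_between mtopology x y h \<longrightarrow> reparametrization g h)" by blast
qed

section \<open>The merge function and its quotient\<close>

locale merge_function =
  fixes X :: "'a topology" and f :: "'a \<Rightarrow> real"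
  assumes connected: "connected_space X" and bdd: "bdd_above (f ` topspace X)"
begin

abbreviation m where "m \<equiv> merge_fun X f"
abbreviation t where "t \<equiv> merge_pdist X f"

lemma le_Sup_connected: "\<lbrakk>connectedin X A; a \<in> A\<rbrakk> \<Longrightarrow> f a \<le> Sup (f ` A)"
  by (intro cSup_upper bdd_above_mono[OF bdd] image_mono connectedin_subset_topspace) auto

lemma merge_fun_le:
  assumes "connectedin X A" "x \<in> A" "y \<in> A" "\<And>a. a \<in> A \<Longrightarrow> f a \<le> c"
  shows "m x y \<le> c"
proof -
  have "m x y \<le> Sup (f ` A)"
    unfolding merge_fun_def
  proof (rule cInf_lower)
    show "bdd_below {Sup (f ` A) |A. connectedin X A \<and> x \<in> A \<and> y \<in> A}"
      using le_Sup_connected by (intro bdd_belowI[of _ "f x"]) auto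
  qed (use assms in blast)
  also have "\<dots> \<le> c" using assms by (intro cSup_least) auto
  finally show ?thesis .
qed

lemma merge_fun_set_nonempty:
  assumes "x \<in> topspace X" "y \<in> topspace X"
  shows "{Sup (f ` A) |A. connectedin X A \<and> x \<in> A \<and> y \<in> A} \<noteq> {}"
  using assms connected connectedin_topspace[of X] by blast

lemma connected_below_if_merge_fun_less:
  assumes "m x y < c" "x \<in> topspace X" "y \<in> topspace X"
  obtains A where "connectedin X A" "x \<in> A" "y \<in> A" "\<And>a. a \<in> A \<Longrightarrow> f a \<le> c"
proof -
  obtain A where A: "connectedin X A" "x \<in> A" "y \<in> A" "Sup (f ` A) < c"
    using cInf_lessD[OF merge_fun_set_nonempty[OF assms(2,3)]] assms(1)
    unfolding merge_fun_def by blast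
  then show ?thesis using that le_Sup_connected by fastforce
qed

lemma merge_fun_ge:
  assumes "x \<in> topspace X" "y \<in> topspace X"
  shows "f x \<le> m x y"
  unfolding merge_fun_def
  by (rule cInf_greatest[OF merge_fun_set_nonempty[OF assms]]) (auto intro: le_Sup_connected)

lemma merge_fun_refl:
  assumes "x \<in> topspace X"
  shows "m x x = f x"
proof (rule antisym)
  show "m x x \<le> f x"
    by (rule merge_fun_le[of "{x}"]) (use assms in \<open>auto simp: connectedin_sing\<close>)
qed (use assms merge_fun_ge in blast)

lemma merge_fun_commute: "m x y = m y x"
  unfolding merge_fun_def by (metis (no_types, lifting))

lemma merge_fun_ultrametric:
  assumes "x \<in> topspace X" "y \<in> topspace X" "z \<in> topspace X"
  shows "m x z \<le> max (m x y) (m y z)"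
proof (rule dense_ge)
  fix c assume "max (m x y) (m y z) < c"
  then have less: "m x y < c" "m y z < c" by auto
  obtain A where A: "connectedin X A" "x \<in> A" "y \<in> A" "\<And>a. a \<in> A \<Longrightarrow> f a \<le> c"
    using connected_below_if_merge_fun_less[OF less(1)] assms by metis
  obtain B where B: "connectedin X B" "y \<in> B" "z \<in> B" "\<And>a. a \<in> B \<Longrightarrow> f a \<le> c"
    using connected_below_if_merge_fun_less[OF less(2)] assms by metis
  have "connectedin X (A \<union> B)" using A B by (intro connectedin_Un) auto
  then show "m x z \<le> c" by (rule merge_fun_le) (use A B in auto)
qed

lemma pdist_nonneg:
  assumes "x \<in> topspace X" "y \<in> topspace X"
  shows "0 \<le> t x y"
  using merge_fun_ge[OF assms] merge_fun_ge[OF assms(2,1)] merge_fun_commute[of x y]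
  by (simp add: merge_pdist_def)

lemma pdist_commute: "t x y = t y x"
  using merge_fun_commute[of x y] by (simp add: merge_pdist_def)

lemma pdist_triangle:
  assumes "x \<in> topspace X" "y \<in> topspace X" "z \<in> topspace X"
  shows "t x z \<le> t x y + t y z"
  using merge_fun_ultrametric[OF assms] merge_fun_ge[of y x] merge_fun_ge[of y z] assms
    merge_fun_commute[of x y]
  by (simp add: merge_pdist_def max_def split: if_splits)

text \<open>In terms of \<open>m\<close> the claim is \<open>m x z + m p y \<le> max (m x y + m p z) (m y z + m p x)\<close>. The ultrametric
  inequality bounds \<open>m x z\<close> by one of \<open>m x y\<close>, \<open>m y z\<close> and by one of \<open>m p x\<close>, \<open>m p z\<close>, and it bounds
  \<open>m p y\<close> by one of \<open>m p x\<close>, \<open>m x y\<close> and by one of \<open>m p z\<close>, \<open>m y z\<close>. Whichever these are, one bound for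
  \<open>m x z\<close> and one for \<open>m p y\<close> form a sum on the right.\<close>
lemma pdist_four_point:
  assumes "p \<in> topspace X" "x \<in> topspace X" "y \<in> topspace X" "z \<in> topspace X"
  shows "min (gromov_product t p x y) (gromov_product t p y z) \<le> gromov_product t p x z"
proof -
  have "m x z \<le> max (m x y) (m y z)" "m x z \<le> max (m p x) (m p z)"
    "m p y \<le> max (m p x) (m x y)" "m p y \<le> max (m p z) (m y z)"
    using merge_fun_ultrametric[of x y z] merge_fun_ultrametric[of x p z]
      merge_fun_ultrametric[of p x y] merge_fun_ultrametric[of p z y] assms
    by (simp_all add: merge_fun_commute)
  then have "m x z + m p y \<le> max (m x y + m p z) (m y z + m p x)"
    by (auto simp: max_def split: if_splits)
  then show ?thesis
    by (auto simp: gromov_product_def merge_pdist_def min_def max_def field_simps split: if_splits)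
qed

abbreviation proj where "proj x \<equiv> merge_rel X f `` {x}"

lemma equiv_merge_rel: "equiv (topspace X) (merge_rel X f)"
proof (rule equivI)
  show "refl_on (topspace X) (merge_rel X f)"
    by (auto simp: refl_on_def merge_rel_def merge_pdist_def merge_fun_refl)
  show "sym (merge_rel X f)"
    by (auto simp: sym_def merge_rel_def pdist_commute)
  show "trans (merge_rel X f)"
  proof (rule transI)
    fix x y z assume "(x, y) \<in> merge_rel X f" "(y, z) \<in> merge_rel X f"
    then show "(x, z) \<in> merge_rel X f"
      using pdist_triangle[of x y z] pdist_nonneg[of x z] by (auto simp: merge_rel_def)
  qed
qed (auto simp: merge_rel_def)

lemma proj_in_merge_tree: "x \<in> topspace X \<Longrightarrow> proj x \<in> merge_tree X f"
  unfolding merge_tree_def by (rule quotientI)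

lemma merge_tree_cases:
  assumes "P \<in> merge_tree X f"
  obtains x where "x \<in> topspace X" "P = proj x"
  using assms unfolding merge_tree_def by (rule quotientE) blast

lemma proj_eq_iff: "\<lbrakk>x \<in> topspace X; y \<in> topspace X\<rbrakk> \<Longrightarrow> proj x = proj y \<longleftrightarrow> t x y = 0"
  using eq_equiv_class_iff[OF equiv_merge_rel] by (simp add: merge_rel_def)

text \<open>The triangle inequality makes the merge pseudodistance independent of the representatives, so
  that all computations in the quotient can be carried out with points of \<open>X\<close>.\<close>
lemma merge_dist_proj:
  assumes "x \<in> topspace X" "y \<in> topspace X"
  shows "merge_dist X f (proj x) (proj y) = t x y"
proof -
  have some: "(SOME u. u \<in> proj x) \<in> topspace X \<and> t x (SOME u. u \<in> proj x) = 0"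
    if "x \<in> topspace X" for x
  proof -
    have "x \<in> proj x" using equiv_class_self[OF equiv_merge_rel that] .
    then have "(SOME u. u \<in> proj x) \<in> proj x" by (rule someI)
    then show ?thesis by (auto simp: merge_rel_def)
  qed
  define u v where "u = (SOME u. u \<in> proj x)" and "v = (SOME v. v \<in> proj y)"
  have uv: "u \<in> topspace X" "t x u = 0" "v \<in> topspace X" "t y v = 0"
    using some assms by (auto simp: u_def v_def)
  have "t u v \<le> t u x + (t x y + t y v)" "t x y \<le> t x u + (t u v + t v y)"
    using pdist_triangle[of u x v] pdist_triangle[of x y v] pdist_triangle[of x u y]
      pdist_triangle[of u v y] uv assms by linarith+
  then have "t u v = t x y" using uv pdist_commute[of u x] pdist_commute[of v y] by linarith
  then show ?thesis
    using assms by (simp add: merge_dist_def proj_in_merge_tree u_def v_def)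
qed

sublocale zero_hyperbolic_space "merge_tree X f" "merge_dist X f"
proof
  have cases: "\<exists>x y. P = proj x \<and> Q = proj y \<and> x \<in> topspace X \<and> y \<in> topspace X"
    if "P \<in> merge_tree X f" "Q \<in> merge_tree X f" for P Q
    using that merge_tree_cases by metis
  fix P Q R S
  show "0 \<le> merge_dist X f P Q"
  proof (cases "P \<in> merge_tree X f \<and> Q \<in> merge_tree X f")
    case True
    then show ?thesis using cases[of P Q] by (auto simp: merge_dist_proj pdist_nonneg)
  qed (auto simp: merge_dist_def)
  show "merge_dist X f P Q = merge_dist X f Q P"
    by (simp add: merge_dist_def pdist_commute)
  assume P: "P \<in> merge_tree X f" and Q: "Q \<in> merge_tree X f"
  obtain p q where pq: "P = proj p" "Q = proj q" "p \<in> topspace X" "q \<in> topspace X"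
    using cases[OF P Q] by blast
  show "merge_dist X f P Q = 0 \<longleftrightarrow> P = Q"
    using pq by (simp add: merge_dist_proj proj_eq_iff)
  assume R: "R \<in> merge_tree X f"
  obtain r where r: "R = proj r" "r \<in> topspace X" using R merge_tree_cases by metis
  show "merge_dist X f P R \<le> merge_dist X f P Q + merge_dist X f Q R"
    using pq r by (simp add: merge_dist_proj pdist_triangle)
  assume S: "S \<in> merge_tree X f"
  obtain s where s: "S = proj s" "s \<in> topspace X" using S merge_tree_cases by metis
  have "gromov_product (merge_dist X f) (proj x) (proj y) (proj z) = gromov_product t x y z"
    if "x \<in> topspace X" "y \<in> topspace X" "z \<in> topspace X" for x y z
    using that by (simp add: gromov_product_def merge_dist_proj)
  then show "min (gromov_product (merge_dist X f) P Q R) (gromov_product (merge_dist X f) P R S)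
      \<le> gromov_product (merge_dist X f) P Q S"
    using pq r s pdist_four_point by simp
qed

text \<open>If \<open>f\<close> differs from \<open>f x\<close> by less than \<open>\<epsilon> / 3\<close> on a connected neighbourhood \<open>U\<close> of \<open>x\<close>, then
  \<open>U\<close> itself witnesses that \<open>m x y \<le> f x + \<epsilon> / 3\<close> for \<open>y \<in> U\<close>, so that \<open>t x y < \<epsilon>\<close>.\<close>
lemma continuous_map_proj:
  assumes f: "continuous_map X euclideanreal f" and loc: "locally_connected_space X"
  shows "continuous_map X mtopology (\<lambda>x. proj x)"
  unfolding continuous_map_to_metric
proof (intro ballI allI impI)
  fix x and \<epsilon> :: real assume x: "x \<in> topspace X" and \<epsilon>: "0 < \<epsilon>"
  define W where "W = {y \<in> topspace X. f y \<in> ball (f x) (\<epsilon> / 3)}"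
  have "openin X W"
    unfolding W_def by (rule openin_continuous_map_preimage[OF f]) simp
  moreover have "x \<in> W" using x \<epsilon> by (simp add: W_def)
  ultimately obtain U where U: "openin X U" "connectedin X U" "x \<in> U" "U \<subseteq> W"
    using loc unfolding locally_connected_space by metis
  have fU: "\<bar>f y - f x\<bar> < \<epsilon> / 3" if "y \<in> U" for y
    using U(4) that by (auto simp: W_def dist_real_def abs_minus_commute)
  have "proj y \<in> mball (proj x) \<epsilon>" if y: "y \<in> U" for y
  proof -
    have yX: "y \<in> topspace X" using U y by (auto simp: W_def)
    have "m x y \<le> f x + \<epsilon> / 3"
    proof (rule merge_fun_le[OF U(2,3) y])
      show "f a \<le> f x + \<epsilon> / 3" if "a \<in> U" for a using fU[OF that] by linarith
    qed
    then have "t x y < \<epsilon>" using fU[OF y] unfolding merge_pdist_def by linarith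
    then show ?thesis using x yX by (simp add: merge_dist_proj proj_in_merge_tree)
  qed
  with U show "\<exists>U. openin X U \<and> x \<in> U \<and> (\<forall>y\<in>U. proj y \<in> mball (proj x) \<epsilon>)" by blast
qed

lemma connected_merge_tree:
  assumes "continuous_map X euclideanreal f" "locally_connected_space X"
  shows "connected_space mtopology"
proof -
  have "connectedin mtopology ((\<lambda>x. proj x) ` topspace X)"
    using continuous_map_proj[OF assms] connected
    by (intro connectedin_continuous_map_image) (auto simp: connectedin_topspace)
  moreover have "(\<lambda>x. proj x) ` topspace X = merge_tree X f"
    by (auto simp: proj_in_merge_tree elim!: merge_tree_cases)
  ultimately show ?thesis by (metis connectedin_topspace topspace_mtopology)
qed

end

section \<open>Geodesic spaces are locally connected\<close>

text \<open>The left-hand side is the inscribed sum of the partition \<open>0 \<le> t \<le> 1\<close>.\<close>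
lemma dist_add_dist_le_path_length:
  assumes "t \<in> {0..1}"
  shows "ennreal (d (g 0) (g t) + d (g t) (g 1)) \<le> path_length d g"
  unfolding path_length_def
proof (rule Sup_upper, intro CollectI exI conjI)
  let ?s = "\<lambda>i::nat. if i = 0 then 0 else if i = 1 then t else 1"
  show "ennreal (d (g 0) (g t) + d (g t) (g 1)) = ennreal (\<Sum>i<2. d (g (?s i)) (g (?s (Suc i))))"
    by (simp add: numeral_2_eq_2)
  show "mono_on {..2} ?s" using assms by (auto simp: monotone_on_def)
qed auto

text \<open>A geodesic that starts at the centre of a ball and ends in the ball stays in it, since its
  points are no farther from the start than its end.\<close>
lemma locally_connected_geodesic_space:
  assumes "geodesic_space M d"
  shows "locally_connected_space (Metric_space.mtopology M d)"
proof -
  interpret Metric_space M d using assms by (simp add: geodesic_space_def)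
  show ?thesis
    unfolding locally_connected_space_im_kleinen
  proof (intro allI impI)
    fix V x assume "openin mtopology V \<and> x \<in> V"
    then obtain r where r: "r > 0" "mball x r \<subseteq> V" and x: "x \<in> M"
      unfolding openin_mtopology by blast
    have "\<exists>C. connectedin mtopology C \<and> C \<subseteq> V \<and> x \<in> C \<and> y \<in> C" if y: "y \<in> mball x r" for y
    proof -
      have yM: "y \<in> M" using y by simp
      then obtain g where g: "pathin mtopology g" "g 0 = x" "g 1 = y"
        "path_length d g = ennreal (d x y)"
        using assms x unfolding geodesic_space_def by metis
      have "g s \<in> mball x r" if s: "s \<in> {0..1}" for s
      proof -
        have "g s \<in> M" using path_image_subset_topspace[OF g(1)] s by auto
        moreover have "d x (g s) + d (g s) y \<le> d x y"
          using dist_add_dist_le_path_length[OF s, of d g] g by (simp add: ennreal_le_iff flip: ennreal_plus)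
        then have "d x (g s) < r" using y nonneg[of "g s" y] by (simp del: nonneg)
        ultimately show ?thesis using x by simp
      qed
      then have "g ` {0..1} \<subseteq> V" using r by blast
      moreover have "x \<in> g ` {0..1}" "y \<in> g ` {0..1}" using g by force+
      ultimately show ?thesis using connectedin_path_image[OF g(1)] by blast
    qed
    then show "\<exists>U. openin mtopology U \<and> x \<in> U \<and> U \<subseteq> V \<and>
        (\<forall>y\<in>U. \<exists>C. connectedin mtopology C \<and> C \<subseteq> V \<and> x \<in> C \<and> y \<in> C)"
      using r x by (intro exI[of _ "mball x r"]) auto
  qed
qed

section \<open>Hyperbolicity and tree structure of the merge tree\<close>

theorem proposition6p4:
  fixes X :: "'a topology" and f :: "'a \<Rightarrow> real"
  assumes "compact_space X" and "connected_space X"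
    and "continuous_map X euclideanreal f"
  shows "Metric_space (merge_tree X f) (merge_dist X f) \<and>
         hyperbolicity (merge_tree X f) (merge_dist X f) = 0 \<and>
         ((\<exists>d. geodesic_space (topspace X) d \<and> Metric_space.mtopology (topspace X) d = X)
            \<longrightarrow> metric_tree (merge_tree X f) (merge_dist X f))"
proof -
  have "compact (f ` topspace X)"
    using image_compactin[OF _ assms(3)] assms(1) by (simp add: compact_space_def)
  then interpret merge_function X f
    using assms(2) by unfold_locales (auto intro: bounded_imp_bdd_above compact_imp_bounded)
  show ?thesis
  proof (intro conjI impI)
    show "Metric_space (merge_tree X f) (merge_dist X f)" by (rule Metric_space_axioms)
    show "hyperbolicity (merge_tree X f) (merge_dist X f) = 0" by (rule hyperbolicity_zero)
    assume "\<exists>d. geodesic_space (topspace X) d \<and> Metric_space.mtopology (topspace X) d = X"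
    then have "locally_connected_space X" using locally_connected_geodesic_space by metis
    then show "metric_tree (merge_tree X f) (merge_dist X f)"
      by (intro metric_tree_if_connected connected_merge_tree assms(3))
  qed
qed

end
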